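(* An $n\times n$ dual transitional probability matrix (DTPM) is dynamically reversible if and only if it is a permutation matrix.
   Context: Dual numbers: $\mathbb{DR}=\{p_{\rm s}+p_{\rm i}\epsilon: p_{\rm s},p_{\rm i}\in\mathbb{R}\}$ with $\epsilon\neq0$, $\epsilon^2=0$ (a commutative ring), with total order $p<q$ if $p_{\rm s}<q_{\rm s}$, or $p_{\rm s}=q_{\rm s}$ and $p_{\rm i}<q_{\rm i}$. Dual matrices are written $\boldsymbol{P}=\boldsymbol{P}_{\rm s}+\boldsymbol{P}_{\rm i}\epsilon$ with real $\boldsymbol{P}_{\rm s},\boldsymbol{P}_{\rm i}$. $\mathbf{1}$ is the all-ones vector in $\mathbb{R}^n$. An $n\times n$ DTPM is a dual matrix $\boldsymbol{P}\in\mathbb{DR}^{n\times n}$ all of whose entries are $\ge0$ in the total order and with $\mathbf{1}^\top\boldsymbol{P}=\mathbf{1}^\top$. A DTPM is called a permutation matrix if $\boldsymbol{P}_{\rm s}$ is a permutation matrix and $\boldsymbol{P}_{\rm i}=\boldsymbol{O}$. A DTPM $\boldsymbol{P}$ is called dynamically reversible if $\boldsymbol{P}$ is invertible (there is $\boldsymbol{B}\in\mathbb{DR}^{n\times n}$ with $\boldsymbol{P}\boldsymbol{B}=\boldsymbol{B}\boldsymbol{P}=\boldsymbol{I}_n$) and $\boldsymbol{P}^{-1}$ is also a DTPM. *)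

theory Defs
  imports "HOL-Analysis.Analysis"
begin

section \<open>Dual numbers\<close>

text \<open>The dual number \<open>p\<^sub>s + p\<^sub>i \<epsilon>\<close> is \<open>Dual p\<^sub>s p\<^sub>i\<close>.\<close>

datatype dual = Dual (std_part: real) (inf_part: real)

lemma dual_eq_iff: "p = q \<longleftrightarrow> std_part p = std_part q \<and> inf_part p = inf_part q"
  by (cases p; cases q) simp

text \<open>Multiplication is determined by \<open>\<epsilon> * \<epsilon> = 0\<close>.\<close>

instantiation dual :: comm_ring_1
begin

definition "0 = Dual 0 0"
definition "1 = Dual 1 0"
definition "p + q = Dual (std_part p + std_part q) (inf_part p + inf_part q)"
definition "- p = Dual (- std_part p) (- inf_part p)"
definition "p - q = Dual (std_part p - std_part q) (inf_part p - inf_part q)"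
definition "p * q =
  Dual (std_part p * std_part q) (std_part p * inf_part q + inf_part p * std_part q)"

instance
  by standard
    (simp_all add: zero_dual_def one_dual_def plus_dual_def uminus_dual_def minus_dual_def
      times_dual_def algebra_simps dual_eq_iff)

end

definition dual_eps :: dual where
  "dual_eps = Dual 0 1"

lemma dual_eps_nonzero: "dual_eps \<noteq> 0"
  by (simp add: dual_eps_def zero_dual_def)

lemma dual_eps_square: "dual_eps\<^sup>2 = 0"
  by (simp add: dual_eps_def zero_dual_def times_dual_def power2_eq_square)

lemma dual_decomp: "p = Dual (std_part p) 0 + Dual (inf_part p) 0 * dual_eps"
  by (simp add: dual_eps_def plus_dual_def times_dual_def)

instantiation dual :: linorder
begin

definition "p < q \<longleftrightarrow>
  std_part p < std_part q \<or> std_part p = std_part q \<and> inf_part p < inf_part q"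
definition "p \<le> q \<longleftrightarrow> p < q \<or> (p::dual) = q"

instance
  by standard (auto simp: less_dual_def less_eq_dual_def dual_eq_iff)

end


section \<open>Dual matrices\<close>

definition std_mat :: "dual ^ 'n ^ 'm \<Rightarrow> real ^ 'n ^ 'm" where
  "std_mat P = (\<chi> i j. std_part (P $ i $ j))"

definition inf_mat :: "dual ^ 'n ^ 'm \<Rightarrow> real ^ 'n ^ 'm" where
  "inf_mat P = (\<chi> i j. inf_part (P $ i $ j))"

definition real_permutation_matrix :: "real ^ 'n ^ 'n \<Rightarrow> bool" where
  "real_permutation_matrix A \<longleftrightarrow>
    (\<exists>p. p permutes UNIV \<and> A = (\<chi> i j. if i = p j then 1 else 0))"

text \<open>The vector \<open>1\<close> below is the all-ones vector, so \<open>1 v* P\<close> is the row of column sums.\<close>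

definition dtpm :: "dual ^ 'n ^ 'n \<Rightarrow> bool" where
  "dtpm P \<longleftrightarrow> (\<forall>i j. 0 \<le> P $ i $ j) \<and> 1 v* P = 1"

definition permutation_dtpm :: "dual ^ 'n ^ 'n \<Rightarrow> bool" where
  "permutation_dtpm P \<longleftrightarrow> dtpm P \<and> real_permutation_matrix (std_mat P) \<and> inf_mat P = 0"

text \<open>\<open>matrix_inv\<close> is the unique two-sided inverse of an invertible matrix and
  unspecified otherwise, hence the explicit invertibility condition.\<close>

definition dynamically_reversible :: "dual ^ 'n ^ 'n \<Rightarrow> bool" where
  "dynamically_reversible P \<longleftrightarrow> dtpm P \<and> invertible P \<and> dtpm (matrix_inv P)"

end

theory Submission
  imports Defs
begin

text \<open>
  The dual numbers are an ordered commutative ring, so a vanishing sum of nonnegative products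
  has only vanishing terms, and they are a local ring whose units are the elements with nonzero
  standard part. If \<open>P\<close> and \<open>B\<close> are nonnegative and mutually inverse, the off-diagonal entries
  of \<open>P ** B\<close> say \<open>P $ k $ j * B $ j $ i = 0\<close> for all \<open>k \<noteq> i\<close> and all \<open>j\<close>. On the
  other hand \<open>(B ** P) $ j $ j = 1\<close>, so by locality some product \<open>B $ j $ i * P $ i $ j\<close> is a
  unit; cancelling \<open>B $ j $ i\<close> shows that column \<open>j\<close> of \<open>P\<close> vanishes outside row \<open>i\<close>
  (\<open>nonneg_inverse_column\<close>). Since the columns of \<open>P\<close> sum to \<open>1\<close>, its entry in row \<open>i\<close> is the dual number
  \<open>1\<close>. So \<open>P\<close> is the matrix of a self-map of the index set, and this map is injective because
  \<open>P\<close> is invertible. Cancelling in the dual numbers themselves treats standard and infinitesimal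
  parts at once, which is why \<open>P\<close> has no infinitesimal part. Conversely the matrix of a
  permutation has the matrix of the inverse permutation as its inverse.
\<close>

instance dual :: ordered_comm_ring
proof
  fix a b c :: dual
  show "a \<le> b \<Longrightarrow> c + a \<le> c + b"
    by (auto simp: less_eq_dual_def less_dual_def plus_dual_def)
  show "a \<le> b \<Longrightarrow> 0 \<le> c \<Longrightarrow> c * a \<le> c * b"
    by (cases a; cases b; cases c)
      (auto simp: less_eq_dual_def less_dual_def times_dual_def zero_dual_def mult_left_mono)
qed

instance dual :: zero_less_one
  by standard (simp add: less_dual_def zero_dual_def one_dual_def)

lemma std_part_sum: "std_part (sum f A) = (\<Sum>x\<in>A. std_part (f x))"
  by (induction A rule: infinite_finite_induct) (simp_all add: zero_dual_def plus_dual_def)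

text \<open>A zero divisor of the dual numbers is a multiple of \<open>\<epsilon>\<close>.\<close>

lemma dual_mult_eq_0_iff: "std_part p \<noteq> 0 \<Longrightarrow> p * q = 0 \<longleftrightarrow> q = 0"
  by (auto simp: zero_dual_def times_dual_def dual_eq_iff)

lemma matrix_mult_nth: "(A ** B) $ i $ k = (\<Sum>j\<in>UNIV. A $ i $ j * B $ j $ k)"
  by (simp add: matrix_matrix_mult_def)

lemma dtpm_column_sum: "dtpm P \<Longrightarrow> (\<Sum>i\<in>UNIV. P $ i $ j) = 1"
  by (auto simp: dtpm_def vector_matrix_mult_def vec_eq_iff)

lemma dtpm_nonneg: "dtpm P \<Longrightarrow> 0 \<le> P $ i $ j"
  by (simp add: dtpm_def)

text \<open>The index \<open>i\<close> is chosen so that \<open>B $ j $ i\<close> is a unit. An off-diagonal entry of column \<open>i\<close>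
  of \<open>P ** B\<close> is a vanishing sum of nonnegative products, and its \<open>j\<close>-th term is an entry of
  column \<open>j\<close> of \<open>P\<close> multiplied by that unit.\<close>

lemma nonneg_inverse_column:
  fixes P B :: "dual ^ 'n ^ 'n"
  assumes P: "\<And>i j. 0 \<le> P $ i $ j" and B: "\<And>i j. 0 \<le> B $ i $ j"
    and PB: "P ** B = mat 1" and BP: "B ** P = mat 1"
  obtains i where "\<And>k. k \<noteq> i \<Longrightarrow> P $ k $ j = 0"
proof -
  have "(\<Sum>i\<in>UNIV. B $ j $ i * P $ i $ j) = 1"
    using BP matrix_mult_nth[of B P j j] by (simp add: mat_def)
  then have "(\<Sum>i\<in>UNIV. std_part (B $ j $ i * P $ i $ j)) \<noteq> 0"
    by (simp flip: std_part_sum add: one_dual_def)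
  then obtain i where "std_part (B $ j $ i * P $ i $ j) \<noteq> 0"
    by (rule sum.not_neutral_contains_not_neutral)
  then have unit: "std_part (B $ j $ i) \<noteq> 0"
    by (auto simp: times_dual_def)
  have "P $ k $ j = 0" if "k \<noteq> i" for k
  proof -
    have "(\<Sum>l\<in>UNIV. P $ k $ l * B $ l $ i) = 0"
      using PB matrix_mult_nth[of P B k i] that by (simp add: mat_def)
    then have "P $ k $ j * B $ j $ i = 0"
      by (subst (asm) sum_nonneg_eq_0_iff) (auto simp: P B)
    then show ?thesis
      using unit by (simp add: mult.commute dual_mult_eq_0_iff)
  qed
  with that show ?thesis by blast
qed

text \<open>Since \<open>p\<close> need not be a permutation, these are all the column-stochastic matrices with entries in
  \<open>{0, 1}\<close>, and composition of maps becomes multiplication of matrices.\<close>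

definition self_map_matrix :: "('n \<Rightarrow> 'n) \<Rightarrow> 'a::zero_neq_one ^ 'n ^ 'n" where
  "self_map_matrix p = (\<chi> i j. if i = p j then 1 else 0)"

lemma self_map_matrix_mult:
  "(self_map_matrix p :: 'a::comm_ring_1 ^ 'n ^ 'n) ** self_map_matrix q = self_map_matrix (p \<circ> q)"
proof -
  have "(\<Sum>k\<in>UNIV. (if i = p k then 1 else 0) * (if k = q j then 1 else 0))
      = (if i = p (q j) then 1 else 0 :: 'a)" for i j
    by (simp add: if_distrib[where f = "(*) _"] cong: if_cong)
  then show ?thesis
    by (simp add: self_map_matrix_def matrix_matrix_mult_def)
qed

lemma self_map_matrix_id: "self_map_matrix id = (mat 1 :: 'a::comm_ring_1 ^ 'n ^ 'n)"
  by (simp add: self_map_matrix_def mat_def)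

lemma dtpm_self_map_matrix: "dtpm (self_map_matrix p)"
  by (simp add: dtpm_def self_map_matrix_def vector_matrix_mult_def vec_eq_iff)

lemma permutation_dtpm_iff: "permutation_dtpm P \<longleftrightarrow> (\<exists>p. bij p \<and> P = self_map_matrix p)"
proof -
  have "std_mat P = (\<chi> i j. if i = p j then 1 else 0) \<and> inf_mat P = 0 \<longleftrightarrow> P = self_map_matrix p" for p
    by (auto simp: std_mat_def inf_mat_def self_map_matrix_def vec_eq_iff dual_eq_iff
        zero_dual_def one_dual_def)
  moreover have "p permutes UNIV \<longleftrightarrow> bij p" for p :: "'a \<Rightarrow> 'a"
    using bij_imp_permutes[of p UNIV] permutes_bij[of p UNIV] by auto
  ultimately show ?thesis
    unfolding permutation_dtpm_def real_permutation_matrix_def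
    using dtpm_self_map_matrix by blast
qed

lemma dynamically_reversible_iff:
  "dynamically_reversible P \<longleftrightarrow> (\<exists>B. dtpm P \<and> dtpm B \<and> P ** B = mat 1 \<and> B ** P = mat 1)"
proof
  assume "dynamically_reversible P"
  then have P: "dtpm P" "dtpm (matrix_inv P)" and "\<exists>B. P ** B = mat 1 \<and> B ** P = mat 1"
    by (auto simp: dynamically_reversible_def invertible_def)
  from someI_ex[OF this(3)] have "P ** matrix_inv P = mat 1 \<and> matrix_inv P ** P = mat 1"
    by (simp add: matrix_inv_def)
  with P show "\<exists>B. dtpm P \<and> dtpm B \<and> P ** B = mat 1 \<and> B ** P = mat 1"
    by blast
next
  assume "\<exists>B. dtpm P \<and> dtpm B \<and> P ** B = mat 1 \<and> B ** P = mat 1"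
  then obtain B where B: "dtpm P" "dtpm B" "P ** B = mat 1" "B ** P = mat 1" by blast
  then have "invertible P" by (auto simp: invertible_def)
  moreover have "matrix_inv P = B"
    unfolding matrix_inv_def
  proof (rule some_equality)
    fix C assume "P ** C = mat 1 \<and> C ** P = mat 1"
    then show "C = B"
      by (metis B(3) matrix_mul_assoc matrix_mul_lid matrix_mul_rid)
  qed (use B in simp)
  ultimately show "dynamically_reversible P"
    using B by (simp add: dynamically_reversible_def)
qed

theorem theorem6p5:
  fixes P :: "dual ^ 'n ^ 'n"
  assumes "dtpm P"
  shows "dynamically_reversible P \<longleftrightarrow> permutation_dtpm P"
proof
  assume "dynamically_reversible P"
  then obtain B where B: "dtpm B" "P ** B = mat 1" "B ** P = mat 1"
    by (auto simp: dynamically_reversible_iff)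
  have "\<exists>i. \<forall>k. P $ k $ j = (if k = i then 1 else 0)" for j
  proof -
    obtain i where i: "\<And>k. k \<noteq> i \<Longrightarrow> P $ k $ j = 0"
      using nonneg_inverse_column[OF dtpm_nonneg dtpm_nonneg, OF assms B] by blast
    have "1 = (\<Sum>k\<in>UNIV. P $ k $ j)"
      using assms by (simp add: dtpm_column_sum)
    also have "\<dots> = (\<Sum>k\<in>UNIV. if k = i then P $ i $ j else 0)"
      by (rule sum.cong) (auto simp: i)
    finally have "P $ i $ j = 1" by simp
    with i show ?thesis by (intro exI[of _ i]) auto
  qed
  then obtain p where "\<And>j k. P $ k $ j = (if k = p j then 1 else 0)" by metis
  then have P: "P = self_map_matrix p" by (simp add: self_map_matrix_def vec_eq_iff)
  have "inj p"
  proof (rule injI)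
    fix j l assume "p j = p l"
    \<comment> \<open>Columns \<open>j\<close> and \<open>l\<close> of \<open>P\<close> agree, hence also those of \<open>B ** P\<close>.\<close>
    then have "(B ** P) $ j $ j = (B ** P) $ j $ l"
      by (simp add: P self_map_matrix_def matrix_mult_nth)
    then show "j = l" by (simp add: B mat_def split: if_splits)
  qed
  then have "bij p" by (simp add: bij_def finite_UNIV_inj_surj)
  with P show "permutation_dtpm P" by (auto simp: permutation_dtpm_iff)
next
  assume "permutation_dtpm P"
  then obtain p where p: "bij p" and P: "P = self_map_matrix p"
    by (auto simp: permutation_dtpm_iff)
  have "P ** self_map_matrix (inv p) = mat 1" "self_map_matrix (inv p) ** P = mat 1"
    using p by (simp_all add: P self_map_matrix_mult self_map_matrix_id bij_is_inj
        surj_iff[THEN iffD1, OF bij_is_surj])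
  with assms dtpm_self_map_matrix show "dynamically_reversible P"
    by (auto simp: dynamically_reversible_iff)
qed

end
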